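(* Let $V$ be a finite totally ordered set of odd size $|V|=n\geq 5$, identified (via the unique order isomorphism) with $\{0,1,\ldots,n-1\}$ under the natural order, so that $\underline{V}=\underline{n}$. Let $Q$ be a quasi-pairing of $V$ and let $T:=\mathrm{Inv}(\underline{n},Q)$. The tournament $T$ is indecomposable if and only if the following four conditions are all satisfied. (1) The quasi-pairing $Q$ is irreducible. (2) $v_Q^+\geq v_Q^-+2$. (3) For every $v\in\{0,\ldots,n-1\}$, if $\{\{v,v+2\},\{v+1,v+3\}\}\subseteq Q$, then $\hat v_Q\in\{v,v+3\}$. (4) For every $v\in\{0,\ldots,n-1\}$, if $\{v,v+1\}\in Q$, then $\hat v_Q\in\{v,v+1\}\setminus\{0,n-1\}$.
   Context: A tournament $T=(V(T),A(T))$ consists of a finite vertex set $V(T)$ and a set $A(T)$ of ordered pairs of distinct vertices (arcs) such that for all $x\neq y$ in $V(T)$, $(x,y)\in A(T)$ if and only if $(y,x)\notin A(T)$. For a totally ordered set $V$, $\underline{V}$ denotes the transitive tournament $(V,\{(x,y)\in V\times V: x<y\})$; when $V=\{0,\ldots,n-1\}$ with the natural order it is denoted $\underline{n}$. For $Q\subseteq \binom{V}{2}$ (a set of unordered pairs of distinct elements), $\mathrm{Inv}(\underline{V},Q)$ is the tournament on $V$ obtained from $\underline{V}$ by reversing every arc $(x,y)$ such that $\{x,y\}\in Q$; $\cup Q$ denotes the union of the pairs in $Q$. A module of a tournament $T$ is a subset $M\subseteq V(T)$ such that for every $v\in V(T)\setminus M$, either $\{v\}\times M\subseteq A(T)$ or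 $M\times\{v\}\subseteq A(T)$. The trivial modules are $\emptyset$, $V(T)$ and the singletons. $T$ is indecomposable if all its modules are trivial. A quasi-pairing of a set $V$ of size $2m+1$ with $m\geq 1$ is a subset $Q\subseteq\binom{V}{2}$ with $|Q|=m+1$ and $\cup Q=V$. In a quasi-pairing $Q$ exactly one element, denoted $\hat v_Q$, belongs to two pairs of $Q$ and every other element of $V$ belongs to exactly one pair; $v_Q^-<v_Q^+$ denote the two elements such that $\{\hat v_Q,v_Q^-\},\{\hat v_Q,v_Q^+\}\in Q$, and $B_Q:=\{\hat v_Q,v_Q^-,v_Q^+\}$. Let $Q_{\mathrm{part}}:=(Q\setminus\{\{\hat v_Q,v_Q^-\},\{\hat v_Q,v_Q^+\}\})\cup\{B_Q\}$, which is a partition of $V$. An interval of a totally ordered set $V$ is a subset $I\subseteq V$ such that every element of $V\setminus I$ is greater than all the elements of $I$ or smaller than all of them; it is nontrivial if it is neither $\emptyset$, nor a singleton, nor $V$. A partition of $V$ is irreducible if no nontrivial interval of $V$ is a union of blocks. The quasi-pairing $Q$ is irreducible if the partition $Q_{\mathrm{part}}$ is irreducible. *)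

theory Defs
  imports
    "HOL-Library.Ramsey"
    "HOL-Library.Disjoint_Sets"
    "Graph_Theory.Pair_Digraph"
begin

section \<open>Tournaments\<close>

definition tournament :: "'a pair_pre_digraph \<Rightarrow> bool" where
  "tournament T \<longleftrightarrow>
     finite (pverts T) \<and>
     parcs T \<subseteq> {(x, y). x \<in> pverts T \<and> y \<in> pverts T \<and> x \<noteq> y} \<and>
     (\<forall>x \<in> pverts T. \<forall>y \<in> pverts T. x \<noteq> y \<longrightarrow> ((x, y) \<in> parcs T \<longleftrightarrow> (y, x) \<notin> parcs T))"

definition transitive_tournament :: "'a::linorder set \<Rightarrow> 'a pair_pre_digraph" where
  "transitive_tournament V = \<lparr> pverts = V, parcs = {(x, y) \<in> V \<times> V. x < y} \<rparr>"

definition Inv :: "'a pair_pre_digraph \<Rightarrow> 'a set set \<Rightarrow> 'a pair_pre_digraph" where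
  "Inv T Q = \<lparr> pverts = pverts T,
               parcs = {(x, y). (x, y) \<in> parcs T \<and> {x, y} \<notin> Q} \<union>
                       {(y, x) | x y. (x, y) \<in> parcs T \<and> {x, y} \<in> Q} \<rparr>"

definition tmodule :: "'a pair_pre_digraph \<Rightarrow> 'a set \<Rightarrow> bool" where
  "tmodule T M \<longleftrightarrow>
     M \<subseteq> pverts T \<and>
     (\<forall>v \<in> pverts T - M. {v} \<times> M \<subseteq> parcs T \<or> M \<times> {v} \<subseteq> parcs T)"

definition indecomposable :: "'a pair_pre_digraph \<Rightarrow> bool" where
  "indecomposable T \<longleftrightarrow>
     (\<forall>M. tmodule T M \<longrightarrow> M = {} \<or> M = pverts T \<or> is_singleton M)"

lemma tournament_Inv_transitive:
  assumes "finite V"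
  shows "tournament (Inv (transitive_tournament V) Q)"
  using assms
  by (auto simp: tournament_def Inv_def transitive_tournament_def insert_commute)

section \<open>Intervals and irreducible partitions\<close>

definition order_interval :: "'a::linorder set \<Rightarrow> 'a set \<Rightarrow> bool" where
  "order_interval V I \<longleftrightarrow>
     I \<subseteq> V \<and> (\<forall>v \<in> V - I. (\<forall>x \<in> I. x < v) \<or> (\<forall>x \<in> I. v < x))"

definition nontrivial_interval :: "'a::linorder set \<Rightarrow> 'a set \<Rightarrow> bool" where
  "nontrivial_interval V I \<longleftrightarrow>
     order_interval V I \<and> I \<noteq> {} \<and> \<not> is_singleton I \<and> I \<noteq> V"

definition irreducible_partition :: "'a::linorder set \<Rightarrow> 'a set set \<Rightarrow> bool" where
  "irreducible_partition V P \<longleftrightarrow>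
     partition_on V P \<and> \<not> (\<exists>I. nontrivial_interval V I \<and> (\<exists>S \<subseteq> P. I = \<Union>S))"

section \<open>Quasi-pairings\<close>

definition quasi_pairing :: "'a set \<Rightarrow> 'a set set \<Rightarrow> bool" where
  "quasi_pairing V Q \<longleftrightarrow>
     (\<exists>m \<ge> 1. card V = 2 * m + 1 \<and> Q \<subseteq> [V]\<^bsup>2\<^esup> \<and> card Q = m + 1 \<and> \<Union>Q = V)"

text \<open>For a quasi-pairing, the descriptions below denote the intended elements:
  see the lemmas at the end of the theory.\<close>

definition v_hat :: "'a set set \<Rightarrow> 'a" where
  "v_hat Q = (THE v. card {e \<in> Q. v \<in> e} = 2)"

definition v_minus :: "'a::linorder set set \<Rightarrow> 'a" where
  "v_minus Q = Min {w. {v_hat Q, w} \<in> Q}"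

definition v_plus :: "'a::linorder set set \<Rightarrow> 'a" where
  "v_plus Q = Max {w. {v_hat Q, w} \<in> Q}"

definition B_block :: "'a::linorder set set \<Rightarrow> 'a set" where
  "B_block Q = {v_hat Q, v_minus Q, v_plus Q}"

definition Q_part :: "'a::linorder set set \<Rightarrow> 'a set set" where
  "Q_part Q =
     (Q - {{v_hat Q, v_minus Q}, {v_hat Q, v_plus Q}}) \<union> {B_block Q}"

definition irreducible_quasi_pairing :: "'a::linorder set \<Rightarrow> 'a set set \<Rightarrow> bool" where
  "irreducible_quasi_pairing V Q \<longleftrightarrow>
     quasi_pairing V Q \<and> irreducible_partition V (Q_part Q)"

lemma v_hat_quasi_pairing:
  assumes "quasi_pairing V Q"
  shows "v_hat Q \<in> V" "card {e \<in> Q. v_hat Q \<in> e} = 2"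
    "\<And>v. v \<in> V \<Longrightarrow> v \<noteq> v_hat Q \<Longrightarrow> card {e \<in> Q. v \<in> e} = 1"
proof -
  obtain m where m: "card V = 2 * m + 1" "Q \<subseteq> [V]\<^bsup>2\<^esup>" "card Q = m + 1" "\<Union>Q = V"
    using assms by (auto simp: quasi_pairing_def)
  have fin: "finite V" "finite Q"
    using m by (auto intro: card_ge_0_finite)
  define d where "d v = card {e \<in> Q. v \<in> e}" for v
  have pos: "1 \<le> d v" if "v \<in> V" for v
  proof -
    have "{e \<in> Q. v \<in> e} \<noteq> {}" using that m(4) by auto
    then show ?thesis using fin by (simp add: d_def Suc_le_eq card_gt_0_iff)
  qed
  have "sum d V = (\<Sum>e\<in>Q. 2)"
    unfolding d_def
  proof (rule sum_multicount_gen[OF fin], rule ballI)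
    fix e assume "e \<in> Q"
    then have "e \<subseteq> V" "card e = 2" using m(2) by (auto simp: nsets_def)
    moreover from this have "{i \<in> V. i \<in> e} = e" by auto
    ultimately show "card {i \<in> V. i \<in> e} = 2" by simp
  qed
  then have "sum d V = 2 * m + 2" using m(3) by simp
  moreover have "sum d V = (\<Sum>v\<in>V. d v - 1) + card V"
  proof -
    have "sum d V = (\<Sum>v\<in>V. (d v - 1) + 1)"
      using pos by (intro sum.cong refl) (simp only: le_add_diff_inverse2)
    then show ?thesis by (simp only: sum.distrib) simp
  qed
  ultimately have "(\<Sum>v\<in>V. d v - 1) = 1" using m(1) by simp
  then obtain h where h: "h \<in> V" "d h - 1 = 1" and rest: "\<forall>v\<in>V. h \<noteq> v \<longrightarrow> d v - 1 = 0"
    unfolding sum_eq_1_iff[OF fin(1)] by blast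
  have h2: "d h = 2" using h(2) by linarith
  have h1: "d v = 1" if "v \<in> V" "v \<noteq> h" for v
  proof -
    have "d v - 1 = 0" using rest that by simp
    then show ?thesis using pos[OF that(1)] by linarith
  qed
  have eq: "v_hat Q = h"
    unfolding v_hat_def d_def[symmetric]
  proof (rule the_equality)
    show "d h = 2" by (fact h2)
  next
    fix v assume v: "d v = 2"
    then have "{e \<in> Q. v \<in> e} \<noteq> {}" unfolding d_def by (intro notI) simp
    then have "v \<in> V" using m(4) by auto
    then show "v = h" using h1[of v] v by force
  qed
  show "v_hat Q \<in> V" unfolding eq by (fact h(1))
  show "card {e \<in> Q. v_hat Q \<in> e} = 2" unfolding eq using h2 by (simp only: d_def)
  show "card {e \<in> Q. v \<in> e} = 1" if "v \<in> V" "v \<noteq> v_hat Q" for v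
    using h1[of v] that unfolding eq d_def by simp
qed

lemma v_minus_plus_quasi_pairing:
  fixes Q :: "'a::linorder set set"
  assumes "quasi_pairing V Q"
  shows "v_minus Q < v_plus Q"
    "v_minus Q \<noteq> v_hat Q" "v_plus Q \<noteq> v_hat Q"
    "{e \<in> Q. v_hat Q \<in> e} = {{v_hat Q, v_minus Q}, {v_hat Q, v_plus Q}}"
proof -
  define h where "h = v_hat Q"
  have two: "\<And>e. e \<in> Q \<Longrightarrow> card e = 2"
    using assms by (auto simp: quasi_pairing_def nsets_def)
  have "card {e \<in> Q. h \<in> e} = 2"
    using v_hat_quasi_pairing(2)[OF assms] by (simp add: h_def)
  then obtain e1 e2 where e: "{e \<in> Q. h \<in> e} = {e1, e2}" "e1 \<noteq> e2"
    unfolding card_2_iff by (elim exE conjE) (rule that)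
  have *: "\<exists>a. a \<noteq> h \<and> e = {h, a}" if eQ: "e \<in> Q" "h \<in> e" for e
  proof -
    obtain x y where "e = {x, y}" "x \<noteq> y"
      using two[OF eQ(1)] unfolding card_2_iff by (elim exE conjE) (rule that)
    then show ?thesis using eQ(2) by (cases "x = h") auto
  qed
  obtain a b where ab: "a \<noteq> h" "b \<noteq> h" "e1 = {h, a}" "e2 = {h, b}"
  proof -
    have "e1 \<in> {e \<in> Q. h \<in> e}" "e2 \<in> {e \<in> Q. h \<in> e}" unfolding e(1) by simp_all
    then show thesis using *[of e1] *[of e2] that by auto
  qed
  have "a \<noteq> b" using ab e(2) by auto
  have mem: "f \<in> Q \<and> h \<in> f \<longleftrightarrow> f = {h, a} \<or> f = {h, b}" for f
    using e(1) unfolding ab(3,4) by (simp add: set_eq_iff)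
  have "{h, w} \<in> Q \<longleftrightarrow> w = a \<or> w = b" for w
    using mem[of "{h, w}"] ab(1,2) by (simp add: doubleton_eq_iff)
  then have "{w. {h, w} \<in> Q} = {a, b}" by auto
  then have mm: "v_minus Q = min a b" "v_plus Q = max a b"
    by (simp_all add: v_minus_def v_plus_def h_def)
  show "v_minus Q < v_plus Q" using \<open>a \<noteq> b\<close> mm by (auto simp: min_def max_def)
  show "v_minus Q \<noteq> v_hat Q" "v_plus Q \<noteq> v_hat Q"
    using ab mm by (auto simp: min_def max_def h_def)
  show "{e \<in> Q. v_hat Q \<in> e} = {{v_hat Q, v_minus Q}, {v_hat Q, v_plus Q}}"
    using e(1) ab mm by (auto simp: min_def max_def h_def)
qed

lemma partition_on_Q_part:
  fixes Q :: "'a::linorder set set"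
  assumes "quasi_pairing V Q"
  shows "partition_on V (Q_part Q)"
proof -
  define h a b where "h = v_hat Q" and "a = v_minus Q" and "b = v_plus Q"
  note hh = v_hat_quasi_pairing[OF assms, folded h_def]
  note ab = v_minus_plus_quasi_pairing[OF assms, folded h_def a_def b_def]
  have U: "\<Union>Q = V" and two: "\<And>e. e \<in> Q \<Longrightarrow> card e = 2"
    using assms by (auto simp: quasi_pairing_def nsets_def)
  have part: "Q_part Q = (Q - {{h, a}, {h, b}}) \<union> {{h, a, b}}"
    by (simp add: Q_part_def B_block_def h_def a_def b_def)
  have uniq: "e = f" if "e \<in> Q" "f \<in> Q" "v \<in> e" "v \<in> f" "v \<noteq> h" for e f v
  proof -
    have "v \<in> V" using U that by auto
    then have "card {e \<in> Q. v \<in> e} = 1" using \<open>v \<noteq> h\<close> by (rule hh(3))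
    then obtain g where g: "{e \<in> Q. v \<in> e} = {g}" by (rule card_1_singletonE)
    have "e \<in> {e \<in> Q. v \<in> e}" "f \<in> {e \<in> Q. v \<in> e}" using that by simp_all
    then show ?thesis unfolding g by simp
  qed
  have mem: "e \<in> Q \<and> h \<in> e \<longleftrightarrow> e = {h, a} \<or> e = {h, b}" for e
    using ab(4) by (simp add: set_eq_iff)
  have inQ: "{h, a} \<in> Q" "{h, b} \<in> Q" using mem[of "{h, a}"] mem[of "{h, b}"] by simp_all
  have hrem: "h \<notin> e" if "e \<in> Q - {{h, a}, {h, b}}" for e
    using mem[of e] that by simp
  have dB: "e \<inter> {h, a, b} = {}" if e: "e \<in> Q - {{h, a}, {h, b}}" for e
    using hrem[OF e] uniq[of e "{h, a}" a] uniq[of e "{h, b}" b] inQ ab(2,3) e by auto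
  show ?thesis
  proof (rule partition_onI)
    show "\<Union>(Q_part Q) = V"
      unfolding part using U inQ by auto
    fix p q assume pq: "p \<in> Q_part Q" "q \<in> Q_part Q" "p \<noteq> q"
    have "p \<inter> q = {}" if "p \<in> Q - {{h, a}, {h, b}}" "q \<in> Q - {{h, a}, {h, b}}"
      using uniq[of p q] hrem[OF that(1)] that \<open>p \<noteq> q\<close> by blast
    then show "disjnt p q"
      using pq dB unfolding part disjnt_def by blast
  next
    show "{} \<notin> Q_part Q"
      unfolding part using two[of "{}"] by auto
  qed
qed

end

theory Submission
  imports Defs
begin

text \<open>
  View the pairs of \<open>Q\<close> as the edges of a graph: every vertex has degree 1, except \<open>v_hat Q\<close>, which
  has degree 2. A set \<open>M\<close> is a module of the tournament iff every \<open>v \<notin> M\<close> is adjacent, within \<open>M\<close>,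
  either exactly to the elements below \<open>v\<close> or exactly to those above \<open>v\<close>.

  If a condition fails, there is an explicit nontrivial module: an interval that is a union of
  blocks, \<open>{v_minus Q, v_plus Q}\<close>, \<open>{v, v + 3}\<close>, \<open>{v, v + 1}\<close>, or the complement of \<open>{1}\<close> or
  \<open>{n - 2}\<close>.

  Conversely, let \<open>M\<close> be a nontrivial module. Since degrees are at most 2, a vertex outside \<open>M\<close> but
  between its minimum \<open>p\<close> and its maximum \<open>q\<close> is adjacent to \<open>p\<close> or \<open>q\<close>, and if \<open>card M \<ge> 3\<close>, no
  vertex outside \<open>{p..q}\<close> is adjacent to \<open>M\<close>. Hence \<open>{p..q}\<close> is a union of blocks unless \<open>v_hat Q\<close>
  lies in \<open>{p..q} - M\<close>; in that case \<open>v_plus Q = v_minus Q + 1\<close>, or \<open>{p + 2..q}\<close> or its mirror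
  image is a union of blocks. In the remaining case irreducibility
  leaves \<open>p = 0\<close> and \<open>q = n - 1\<close>, where the vertices missing from \<open>M\<close> violate one of the last three
  conditions. Modules with two elements contain few vertices between them and are treated directly.
\<close>

section \<open>Graphs of quasi-pairings and their modules\<close>

text \<open>
  Here \<open>h\<close> is \<open>v_hat Q\<close>, and \<open>a\<close>, \<open>b\<close> are \<open>v_minus Q\<close>, \<open>v_plus Q\<close> in either order, so that the
  reflection \<open>x \<mapsto> n - 1 - x\<close> preserves the locale.
\<close>

locale quasi_pairing_graph =
  fixes n :: nat and E :: "nat \<Rightarrow> nat \<Rightarrow> bool" and h a b :: nat
  assumes n_ge: "5 \<le> n"
    and E_sym: "E x y \<Longrightarrow> E y x"
    and E_less: "E x y \<Longrightarrow> x < n"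
    and E_neq: "E x y \<Longrightarrow> x \<noteq> y"
    and E_ex: "x < n \<Longrightarrow> \<exists>y. E x y"
    and E_unique: "x \<noteq> h \<Longrightarrow> E x y \<Longrightarrow> E x z \<Longrightarrow> y = z"
    and E_hat: "E h y \<longleftrightarrow> y = a \<or> y = b"
    and a_neq_b: "a \<noteq> b"
begin

text \<open>In the tournament, the first alternative says that \<open>v\<close> dominates
  \<open>M\<close>, the second that \<open>M\<close> dominates \<open>v\<close>.\<close>

definition graph_module :: "nat set \<Rightarrow> bool" where
  "graph_module M \<longleftrightarrow> M \<subseteq> {0..<n} \<and>
     (\<forall>v<n. v \<notin> M \<longrightarrow> (\<forall>x\<in>M. x < v \<longleftrightarrow> E v x) \<or> (\<forall>x\<in>M. v < x \<longleftrightarrow> E v x))"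

text \<open>Within the vertex set, these are the unions of connected components; the components are
  the blocks of \<open>Q_part\<close>.\<close>

definition nbr_closed :: "nat set \<Rightarrow> bool" where
  "nbr_closed I \<longleftrightarrow> (\<forall>x y. x \<in> I \<longrightarrow> E x y \<longrightarrow> y \<in> I)"

lemma E_less': "E x y \<Longrightarrow> y < n"
  using E_sym E_less by blast

lemma hat_neq: "h \<noteq> a" "h \<noteq> b"
  using E_hat E_neq by blast+

lemma hat_less: "h < n" "a < n" "b < n"
  using E_hat E_less E_less' by blast+

lemma card_nbr_le_2:
  assumes "\<And>x. x \<in> S \<Longrightarrow> E v x"
  shows "card S \<le> 2"
proof (cases "v = h")
  case True
  then have "S \<subseteq> {a, b}" using assms E_hat by blast
  then show ?thesis using card_mono[of "{a,b}" S] card_insert_le_m1[of 2 "{b}" a] by auto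
next
  case False
  then have "S = {} \<or> (\<exists>e. S = {e})" using assms E_unique by blast
  then show ?thesis by auto
qed

lemma card_nbr_le_1:
  assumes "v \<noteq> h" "\<And>x. x \<in> S \<Longrightarrow> E v x"
  shows "card S \<le> 1"
proof -
  have "S = {} \<or> (\<exists>e. S = {e})" using assms E_unique by blast
  then show ?thesis by auto
qed

lemma graph_module_cases:
  assumes "graph_module M" "v < n" "v \<notin> M"
  obtains "\<And>x. x \<in> M \<Longrightarrow> x < v \<longleftrightarrow> E v x" | "\<And>x. x \<in> M \<Longrightarrow> v < x \<longleftrightarrow> E v x"
  using assms unfolding graph_module_def by blast

lemma graph_module_pair:
  "graph_module {p, q} \<longleftrightarrow> p < n \<and> q < n \<and> (\<forall>v<n. v \<noteq> p \<and> v \<noteq> q \<longrightarrow>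
     (p < v \<longleftrightarrow> E v p) \<and> (q < v \<longleftrightarrow> E v q) \<or> (v < p \<longleftrightarrow> E v p) \<and> (v < q \<longleftrightarrow> E v q))"
  unfolding graph_module_def by simp

text \<open>All of \<open>M\<close> lies on one side of \<open>v\<close>, so either alternative
  makes adjacency to \<open>M\<close> all or nothing, and three neighbours are too many.\<close>

lemma large_module_outer:
  assumes "graph_module M" "3 \<le> card M" "v \<notin> M"
    and "(\<forall>x\<in>M. x < v) \<or> (\<forall>x\<in>M. v < x)" "x \<in> M"
  shows "\<not> E v x"
proof
  assume e: "E v x"
  then have "v < n" by (rule E_less)
  from assms(1) this assms(3) have "E v y" if "y \<in> M" for y
  proof (cases rule: graph_module_cases)
    case 1
    then have "x < v" using e assms(5) by blast
    then have "y < v" using assms(4,5) that by (meson less_asym)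
    then show ?thesis using 1 that by blast
  next
    case 2
    then have "v < x" using e assms(5) by blast
    then have "v < y" using assms(4,5) that by (meson less_asym)
    then show ?thesis using 2 that by blast
  qed
  then have "card M \<le> 2" by (rule card_nbr_le_2)
  then show False using assms(2) by simp
qed

text \<open>A vertex outside \<open>I\<close> has no neighbour in \<open>I\<close> and lies on one
  side of it, so in one of the alternatives both sides of the equivalence are false
  throughout.\<close>

lemma nbr_closed_interval_module:
  assumes "nbr_closed I" "order_interval {0..<n} I"
  shows "graph_module I"
  using assms E_sym unfolding nbr_closed_def order_interval_def graph_module_def
  by (smt (verit, best) DiffI atLeastLessThan_iff le0 order_less_imp_not_less)

text \<open>The guards \<open>x < n\<close> and \<open>y < n\<close> keep the vertex set bounded:
  truncated subtraction sends every \<open>x \<ge> n\<close> to 0.\<close>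

lemma reflect:
  "quasi_pairing_graph n (\<lambda>x y. x < n \<and> y < n \<and> E (n - 1 - x) (n - 1 - y)) (n - 1 - h) (n - 1 - a) (n - 1 - b)"
proof
  let ?r = "\<lambda>x. n - 1 - x"
  have r: "?r x < n" "x < n \<Longrightarrow> ?r (?r x) = x" for x using n_ge by auto
  have ri: "x < n \<Longrightarrow> y < n \<Longrightarrow> ?r x = ?r y \<longleftrightarrow> x = y" for x y by auto
  show "5 \<le> n" by (fact n_ge)
  fix x y z
  show "x < n \<and> y < n \<and> E (?r x) (?r y) \<Longrightarrow> y < n \<and> x < n \<and> E (?r y) (?r x)" using E_sym by blast
  show "x < n \<and> y < n \<and> E (?r x) (?r y) \<Longrightarrow> x < n" by blast
  show "x < n \<and> y < n \<and> E (?r x) (?r y) \<Longrightarrow> x \<noteq> y" using E_neq by blast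
  show "\<exists>y. x < n \<and> y < n \<and> E (?r x) (?r y)" if "x < n"
  proof -
    obtain y where y: "E (?r x) y" using E_ex r(1) by blast
    then have "y < n" by (rule E_less')
    then show ?thesis using y r that by (intro exI[of _ "?r y"]) auto
  qed
  show "y = z" if "x \<noteq> ?r h" "x < n \<and> y < n \<and> E (?r x) (?r y)" "x < n \<and> z < n \<and> E (?r x) (?r z)"
  proof -
    have "?r x \<noteq> h" using that r by metis
    then have "?r y = ?r z" using that E_unique by blast
    then show ?thesis using that ri by blast
  qed
  show "(?r h < n \<and> y < n \<and> E (?r (?r h)) (?r y)) = (y = ?r a \<or> y = ?r b)"
    using r hat_less E_hat by metis
  show "?r a \<noteq> ?r b" using ri hat_less a_neq_b by blast
qed

end

section \<open>Sufficiency: the four conditions and their invariance under reflection\<close>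

text \<open>The assumptions are the four conditions in order. \<open>not_adjacent\<close> is stated
  both ways because reflection reverses the order of \<open>a\<close> and \<open>b\<close>.\<close>

locale good_quasi_pairing_graph = quasi_pairing_graph +
  assumes irred: "l < u \<Longrightarrow> u < n \<Longrightarrow> nbr_closed {l..u} \<Longrightarrow> l = 0 \<and> u = n - 1"
    and not_adjacent: "b \<noteq> a + 1" "a \<noteq> b + 1"
    and crossing: "E v (v + 2) \<Longrightarrow> E (v + 1) (v + 3) \<Longrightarrow> h = v \<or> h = v + 3"
    and short: "E v (v + 1) \<Longrightarrow> (h = v \<or> h = v + 1) \<and> h \<noteq> 0 \<and> h \<noteq> n - 1"
begin

lemma reflect_good:
  "good_quasi_pairing_graph n (\<lambda>x y. x < n \<and> y < n \<and> E (n - 1 - x) (n - 1 - y)) (n - 1 - h) (n - 1 - a) (n - 1 - b)"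
proof -
  let ?r = "\<lambda>x. n - 1 - x"
  interpret R: quasi_pairing_graph n "\<lambda>x y. x < n \<and> y < n \<and> E (?r x) (?r y)" "?r h" "?r a" "?r b"
    by (rule reflect)
  show ?thesis
  proof
    fix l u assume lu: "l < u" "u < n" and cl: "R.nbr_closed {l..u}"
    have "nbr_closed {?r u..?r l}"
      unfolding nbr_closed_def
    proof (intro allI impI)
      fix x y assume x: "x \<in> {?r u..?r l}" and e: "E x y"
      have xy: "x < n" "y < n" using e E_less E_less' by auto
      then have "?r x < n \<and> ?r y < n \<and> E (?r (?r x)) (?r (?r y))" using e by simp
      moreover have "?r x \<in> {l..u}" using x lu xy by auto
      ultimately have "?r y \<in> {l..u}" using cl unfolding R.nbr_closed_def by blast
      then show "y \<in> {?r u..?r l}" using lu xy by auto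
    qed
    moreover have "?r u < ?r l" "?r l < n" using lu by auto
    ultimately have "?r u = 0 \<and> ?r l = n - 1" using irred by blast
    then show "l = 0 \<and> u = n - 1" using lu by auto
  next
    show "?r b \<noteq> ?r a + 1" "?r a \<noteq> ?r b + 1" using not_adjacent hat_less by auto
  next
    fix v
    assume e: "v < n \<and> v + 2 < n \<and> E (?r v) (?r (v + 2))" "v + 1 < n \<and> v + 3 < n \<and> E (?r (v + 1)) (?r (v + 3))"
    \<comment> \<open>The crossing pattern at \<open>v\<close> is reflected onto the one at
      \<open>w\<close>, with its two edges exchanged.\<close>
    define w where "w = ?r (v + 3)"
    have "?r v = w + 3" "?r (v+2) = w + 1" "?r (v + 1) = w + 2" using e unfolding w_def by auto
    then have "E w (w + 2)" "E (w+1) (w+3)" using e E_sym w_def by auto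
    then have "h = w \<or> h = w + 3" by (rule crossing)
    then show "?r h = v \<or> ?r h = v + 3" using e unfolding w_def by auto
  next
    fix v
    assume e: "v < n \<and> v + 1 < n \<and> E (?r v) (?r (v + 1))"
    define w where "w = ?r (v + 1)"
    have "?r v = w + 1" using e unfolding w_def by auto
    then have "E w (w + 1)" using e E_sym w_def by auto
    then have "(h = w \<or> h = w + 1) \<and> h \<noteq> 0 \<and> h \<noteq> n - 1" by (rule short)
    then show "(?r h = v \<or> ?r h = v + 1) \<and> ?r h \<noteq> 0 \<and> ?r h \<noteq> n - 1" 
      using e hat_less unfolding w_def by auto
  qed
qed

text \<open>Reversing the order exchanges the two alternatives of
  \<open>graph_module\<close>.\<close>

lemma reflect_module:
  assumes "graph_module M"
  shows "quasi_pairing_graph.graph_module n (\<lambda>x y. x < n \<and> y < n \<and> E (n - 1 - x) (n - 1 - y)) ((\<lambda>x. n - 1 - x) ` M)"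
proof -
  let ?r = "\<lambda>x. n - 1 - x"
  interpret R: quasi_pairing_graph n "\<lambda>x y. x < n \<and> y < n \<and> E (?r x) (?r y)" "?r h" "?r a" "?r b"
    by (rule reflect)
  have M: "M \<subseteq> {0..<n}" using assms unfolding graph_module_def by blast
  show ?thesis
    unfolding R.graph_module_def
  proof (intro conjI allI impI)
    show "?r ` M \<subseteq> {0..<n}" using n_ge by auto
    fix v assume v: "v < n" "v \<notin> ?r ` M"
    have rM: "?r v \<notin> M"
    proof
      assume "?r v \<in> M"
      then have "?r (?r v) \<in> ?r ` M" by blast
      then show False using v by simp
    qed
    have rv: "?r v < n" using v by auto
    from assms rM rv consider
      "\<forall>x\<in>M. x < ?r v \<longleftrightarrow> E (?r v) x" | "\<forall>x\<in>M. ?r v < x \<longleftrightarrow> E (?r v) x"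
      unfolding graph_module_def by blast
    moreover have "x < n \<and> ?r x < n \<and> ?r (?r x) = x \<and> (?r x < v \<longleftrightarrow> ?r v < x) \<and> (v < ?r x \<longleftrightarrow> x < ?r v)" if "x \<in> M" for x
      using M v that by auto
    ultimately show "(\<forall>x\<in>?r ` M. x < v \<longleftrightarrow> v < n \<and> x < n \<and> E (?r v) (?r x))
        \<or> (\<forall>x\<in>?r ` M. v < x \<longleftrightarrow> v < n \<and> x < n \<and> E (?r v) (?r x))"
      using v by cases auto
  qed
qed

section \<open>Modules with at least three elements\<close>

text \<open>As \<open>h\<close> is adjacent to \<open>p\<close>, no other vertex is. Hence
  \<open>M\<close> has no gap above \<open>p\<close> before \<open>h\<close> or a third element
  \<open>x\<close> of \<open>M\<close>, and the contradiction depends on the order of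
  \<open>x\<close> and \<open>h\<close>.\<close>

lemma large_hat_notin:
  assumes M: "graph_module M" "3 \<le> card M"
    and p: "p \<in> M" "q \<in> M" "\<And>x. x \<in> M \<Longrightarrow> p \<le> x \<and> x \<le> q"
    and h: "h \<notin> M" "p < h" "h < q" "\<And>x. x \<in> M \<Longrightarrow> x < h \<longleftrightarrow> E h x"
  shows False
proof -
  have "\<not> M \<subseteq> {p, q}"
    using M(2) card_mono[of "{p, q}" M] card_insert_le_m1[of 2 "{q}" p] by auto
  then obtain x where x: "x \<in> M" "p < x" "x < q" using p(3) by (metis insert_iff nat_less_le subsetI)
  have hp: "E h p" using h p by blast
  then have ph: "E p z \<Longrightarrow> z = h" for z using E_unique[of p h z] h(2) E_sym by blast
  \<comment> \<open>The first alternative would join \<open>w\<close> to \<open>p\<close>, whose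
    only neighbour is \<open>h\<close>; the second would give \<open>w\<close>, which differs from
    \<open>h\<close>, the two neighbours \<open>x\<close> and \<open>q\<close>.\<close>
  have gap: "w \<in> M" if w: "p < w" "w < h" "w < x" for w
  proof (rule ccontr)
    assume wM: "w \<notin> M"
    have wn: "w < n" using w hat_less by simp
    show False
      using M(1) wn wM
    proof (cases rule: graph_module_cases)
      case 1
      then show False using p(1) w ph E_sym by blast
    next
      case 2
      have "E w x" using 2[OF x(1)] w(3) by blast
      moreover have "E w q" using 2[OF p(2)] w(2) h(3) by simp
      ultimately show False using E_unique[of w x q] w x by simp
    qed
  qed
  show False
  proof (cases "x < h")
    \<comment> \<open>Here \<open>h\<close> has the neighbours \<open>p\<close> and
      \<open>x\<close>, which are not consecutive; then \<open>p + 1\<close>, in \<open>M\<close>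
      and below \<open>h\<close>, would be a third one.\<close>
    case True
    then have "E h x" using x h by blast
    then have ab: "{a, b} = {p, x}" using hp x(2) E_hat by auto
    then have np: "x \<noteq> p + 1" using not_adjacent by (auto simp: doubleton_eq_iff)
    then have "p + 1 \<in> M" using gap[of "p+1"] x True by simp
    moreover have "p + 1 < h" using True x(2) by simp
    ultimately have "E h (p + 1)" using h(4) by blast
    then have "p + 1 \<in> {a, b}" using E_hat by simp
    then show False unfolding ab using np by simp
  next
    case False
    then have hx: "h < x" using x(1) h(1) by (metis nat_neq_iff)
    \<comment> \<open>Otherwise \<open>p + 1\<close> would be in \<open>M\<close> below
      \<open>h\<close>, and the neighbours \<open>p\<close> and \<open>p + 1\<close> of
      \<open>h\<close> would be consecutive.\<close>
    have h1: "h = p + 1"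
    proof (rule ccontr)
      assume "h \<noteq> p + 1"
      then have *: "p + 1 < h" using h by simp
      then have "p + 1 \<in> M" using gap[of "p+1"] hx by simp
      then have "E h (p + 1)" using h(4) * by blast
      then have "{a, b} = {p, p+1}" using hp E_hat by auto
      then show False using not_adjacent by (auto simp: doubleton_eq_iff)
    qed
    \<comment> \<open>Neither \<open>p\<close> nor \<open>h\<close> has a neighbour in this
      interval. Its lower end is positive, contrary to \<open>irred\<close>.\<close>
    have "nbr_closed {p+2..q}"
      unfolding nbr_closed_def
    proof (intro allI impI)
      fix z y assume z: "z \<in> {p+2..q}" and e: "E z y"
      show "y \<in> {p+2..q}"
      proof (cases "z \<in> M")
        case True
        have "\<not> (y < p \<or> q < y)"
        proof
          assume *: "y < p \<or> q < y"
          then have "y \<notin> M" using p(3) leD by blast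
          moreover have "(\<forall>x\<in>M. x < y) \<or> (\<forall>x\<in>M. y < x)" using * p(3) by (meson le_less_trans less_le_trans)
          ultimately show False using large_module_outer[OF M _ _ True] e E_sym by blast
        qed
        moreover have "y \<noteq> h" using h(4)[OF True] e E_sym z h1 by auto
        moreover have "y \<noteq> p" using ph[of z] e E_sym z h1 by auto
        ultimately show ?thesis using h1 by auto
      next
        case False
        have zn: "z < n" using e by (rule E_less)
        have zh: "z \<noteq> h" using z h1 by auto
        show ?thesis using M(1) zn False
        proof (cases rule: graph_module_cases)
          case 1
          have "p < z" using z by simp
          then have "E z p" using 1[OF p(1)] by simp
          then show ?thesis using ph E_sym zh by blast
        next
          case 2
          have "z < q" using z p(2) False by (metis atLeastAtMost_iff nat_less_le)
          then have "E z q" using 2[OF p(2)] by simp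
          then have "y = q" using E_unique[OF zh] e by blast
          then show ?thesis using z by auto
        qed
      qed
    qed
    moreover have "p + 2 < q" using h1 hx x by simp
    moreover have "q < n" using M(1) p(2) unfolding graph_module_def by auto
    ultimately show False using irred by fastforce
  qed
qed

text \<open>A vertex \<open>v\<close> dominating \<open>M\<close> would be adjacent to 0, and so
  would every vertex from 1 to \<open>v\<close>. Now \<open>short\<close> forces
  \<open>h = 1\<close>, since it excludes \<open>h = 0\<close>; then 0 has the two neighbours 1 and
  2.\<close>

lemma large_hat_in:
  assumes M: "graph_module M" "3 \<le> card M" "0 \<in> M" "h \<in> M"
    and v: "v \<notin> M" "v < n" "\<And>x. x \<in> M \<Longrightarrow> x < v \<longleftrightarrow> E v x"
  shows False
proof -
  have hv: "v \<noteq> h" "0 < v" using v(1) M(3,4) gr0I by metis+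
  then have e0: "E v 0" using v M by blast
  have below: "w \<notin> M" if "0 < w" "w \<le> v" for w
  proof
    assume w: "w \<in> M"
    then have "w < v" using that v(1) by (metis nat_less_le)
    then have "E v w" using w v by blast
    then show False using E_unique[OF hv(1) e0] that by blast
  qed
  have nbr: "E w 0" if w: "0 < w" "w \<le> v" for w
  proof -
    have wM: "w \<notin> M" using below w by blast
    have wn: "w < n" using w v(2) by simp
    show ?thesis
      using M(1) wn wM
    proof (cases rule: graph_module_cases)
      case 1
      then show ?thesis using w M(3) by blast
    next
      case 2
      \<comment> \<open>Every element of \<open>M - {0}\<close> exceeds \<open>v\<close>, so
        \<open>w\<close> would be adjacent to at least two vertices although
        \<open>w \<noteq> h\<close>.\<close>
      have "E w x" if "x \<in> M - {0}" for x
        using 2[of x] that below[of x] w by force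
      then have "card (M - {0}) \<le> 1" using wM M(4) by (intro card_nbr_le_1[of w]) auto
      moreover have "card (M - {0}) = card M - 1" using M(3) by (rule card_Diff_singleton)
      ultimately show ?thesis using M(2) by simp
    qed
  qed
  have e1: "E 0 1" using nbr[of 1] hv E_sym by simp
  then have h0: "h = 1" using short[of 0] by auto
  then have "2 \<le> v" using hv by auto
  then have "E 0 2" using nbr[of 2] E_sym by simp
  then show False using E_unique[of 0 1 2] e1 h0 by simp
qed

text \<open>Reflection exchanges the two alternatives for \<open>h\<close> and the roles of
  \<open>p\<close> and \<open>q\<close>.\<close>

lemma large_hat_notin':
  assumes M: "graph_module M" "3 \<le> card M"
    and p: "p \<in> M" "q \<in> M" "\<And>x. x \<in> M \<Longrightarrow> p \<le> x \<and> x \<le> q"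
    and h: "h \<notin> M" "p < h" "h < q" "\<And>x. x \<in> M \<Longrightarrow> h < x \<longleftrightarrow> E h x"
  shows False
proof -
  let ?r = "\<lambda>x. n - 1 - x"
  interpret R: good_quasi_pairing_graph n "\<lambda>x y. x < n \<and> y < n \<and> E (?r x) (?r y)" "?r h" "?r a" "?r b"
    by (rule reflect_good)
  have M1: "M \<subseteq> {0..<n}" using M(1) unfolding graph_module_def by blast
  then have inj: "inj_on ?r M" by (intro inj_on_inverseI[where g="?r"]) auto
  have r: "\<And>x. x \<in> M \<Longrightarrow> ?r (?r x) = x" "?r (?r h) = h" "?r h < n" using M1 hat_less by auto
  show False
  proof (rule R.large_hat_notin)
    show "R.graph_module (?r ` M)" using M(1) by (rule reflect_module)
    show "3 \<le> card (?r ` M)" using M(2) card_image[OF inj] by simp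
    show "?r q \<in> ?r ` M" "?r p \<in> ?r ` M" using p by auto
    show "?r q \<le> x \<and> x \<le> ?r p" if "x \<in> ?r ` M" for x using that p(3) by fastforce
    show "?r h \<notin> ?r ` M" using r h(1) by (metis imageE)
    have "q < n" using p(2) M1 by auto
    then show "?r q < ?r h" "?r h < ?r p" using h(2,3) by auto
    show "x < ?r h \<longleftrightarrow> ?r h < n \<and> x < n \<and> E (?r (?r h)) (?r x)" if xM: "x \<in> ?r ` M" for x
    proof -
      obtain y where y: "y \<in> M" "x = ?r y" using xM by blast
      then have "y < n" using M1 by auto
      then show ?thesis using y h(4)[OF y(1)] r hat_less by auto
    qed
  qed
qed

text \<open>Reflection moves \<open>n - 1\<close> to 0 and exchanges the two alternatives for
  \<open>v\<close>.\<close>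

lemma large_hat_in':
  assumes M: "graph_module M" "3 \<le> card M" "n - 1 \<in> M" "h \<in> M"
    and v: "v \<notin> M" "v < n" "\<And>x. x \<in> M \<Longrightarrow> v < x \<longleftrightarrow> E v x"
  shows False
proof -
  let ?r = "\<lambda>x. n - 1 - x"
  interpret R: good_quasi_pairing_graph n "\<lambda>x y. x < n \<and> y < n \<and> E (?r x) (?r y)" "?r h" "?r a" "?r b"
    by (rule reflect_good)
  have M1: "M \<subseteq> {0..<n}" using M(1) unfolding graph_module_def by blast
  then have inj: "inj_on ?r M" by (intro inj_on_inverseI[where g="?r"]) auto
  have r: "\<And>x. x \<in> M \<Longrightarrow> ?r (?r x) = x" "?r (?r v) = v" "?r v < n" using M1 v by auto
  show False
  proof (rule R.large_hat_in)
    show "R.graph_module (?r ` M)" using M(1) by (rule reflect_module)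
    show "3 \<le> card (?r ` M)" using M(2) card_image[OF inj] by simp
    show "0 \<in> ?r ` M" using M(3) by (intro image_eqI[of _ _ "n - 1"]) auto
    show "?r h \<in> ?r ` M" using M(4) by blast
    show "?r v \<notin> ?r ` M" using r v(1) by (metis imageE)
    show "?r v < n" using r by blast
    show "x < ?r v \<longleftrightarrow> ?r v < n \<and> x < n \<and> E (?r (?r v)) (?r x)" if xM: "x \<in> ?r ` M" for x
    proof -
      obtain y where y: "y \<in> M" "x = ?r y" using xM by blast
      then have "y < n" using M1 by auto
      then show ?thesis using y v(3)[OF y(1)] r v(2) by auto
    qed
  qed
qed

lemma large_module:
  assumes M: "graph_module M" "3 \<le> card M"
  shows "M = {0..<n}"
proof (rule ccontr)
  assume ne: "M \<noteq> {0..<n}"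
  have M1: "M \<subseteq> {0..<n}" using M(1) unfolding graph_module_def by blast
  then have fin: "finite M" using finite_subset by blast
  have M0: "M \<noteq> {}" using M(2) by auto
  define p q where "p = Min M" and "q = Max M"
  have p: "p \<in> M" "q \<in> M" "\<And>x. x \<in> M \<Longrightarrow> p \<le> x \<and> x \<le> q"
    using fin M0 unfolding p_def q_def by auto
  have qn: "q < n" using p M1 by auto
  have inner: "p < x \<and> x < q" if "x \<in> {p..q}" "x \<notin> M" for x
    using that p by (metis atLeastAtMost_iff nat_less_le)
  have hM: "\<not> (p < h \<and> h < q)" if "h \<notin> M"
  proof
    assume "p < h \<and> h < q"
    then have *: "p < h" "h < q" by auto
    from M(1) hat_less(1) that show False
    proof (cases rule: graph_module_cases)
      case 1
      then show False using large_hat_notin[OF M p that *] by blast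
    next
      case 2
      then show False using large_hat_notin'[OF M p that *] by blast
    qed
  qed
  \<comment> \<open>For elements of \<open>M\<close> this is \<open>large_module_outer\<close>. A
    missing vertex inside is not \<open>h\<close> by \<open>hM\<close>, so its only neighbour is
    \<open>p\<close> or \<open>q\<close>.\<close>
  have "nbr_closed {p..q}"
    unfolding nbr_closed_def
  proof (intro allI impI)
    fix x y assume x: "x \<in> {p..q}" and e: "E x y"
    have xn: "x < n" using e by (rule E_less)
    show "y \<in> {p..q}"
    proof (cases "x \<in> M")
      case True
      show ?thesis
      proof (rule ccontr)
        assume "y \<notin> {p..q}"
        then have *: "y < p \<or> q < y" by auto
        then have "y \<notin> M" using p(3) leD by blast
        moreover have "(\<forall>x\<in>M. x < y) \<or> (\<forall>x\<in>M. y < x)" using * p(3) by (meson le_less_trans less_le_trans)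
        ultimately show False using large_module_outer[OF M _ _ True] e E_sym by blast
      qed
    next
      case False
      then have i: "p < x \<and> x < q" using inner x by blast
      then have xh: "x \<noteq> h" using hM False by blast
      from M(1) xn False have "E x p \<or> E x q"
        by (cases rule: graph_module_cases) (use i p in blast)+
      then have "y = p \<or> y = q" using E_unique[OF xh] e by blast
      then show ?thesis using i by auto
    qed
  qed
  moreover have "p < q"
  proof (rule ccontr)
    assume "\<not> p < q"
    then have "M \<subseteq> {p}" using p(3) by force
    then have "card M \<le> 1" using card_mono[of "{p}" M] by simp
    then show False using M(2) by simp
  qed
  ultimately have pq: "p = 0" "q = n - 1" using irred qn by blast+
  have hin: "h \<in> M"
    using hM inner[of h] hat_less(1) pq by auto
  obtain v where "v \<in> {0..<n} - M" using ne M1 by blast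
  then have v: "v < n" "v \<notin> M" by auto
  from M(1) v show False
  proof (cases rule: graph_module_cases)
    case 1
    then show False using large_hat_in[OF M _ hin v(2,1)] p pq by blast
  next
    case 2
    then show False using large_hat_in'[OF M _ hin v(2,1)] p pq by blast
  qed
qed

section \<open>Modules with two elements\<close>

text \<open>A vertex on one side of both elements and adjacent to one is adjacent to the other too;
  only \<open>h\<close> has two neighbours.\<close>

lemma small_outer:
  assumes M: "graph_module {p, q}" and "p < q" "v < p \<or> q < v" "E v p \<or> E v q"
  shows "v = h" "{a, b} = {p, q}"
proof -
  have "v < n" using assms(4) E_less by blast
  then have e: "E v p \<and> E v q"
    using assms by (auto simp: graph_module_def)
  then show vh: "v = h" using E_unique assms(2) by blast
  then show "{a, b} = {p, q}" using e E_hat assms(2) by auto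
qed

text \<open>Exactly one of \<open>p\<close>, \<open>q\<close> is below \<open>v\<close> and exactly
  one above, so both alternatives give exactly one adjacency.\<close>

lemma small_inner:
  assumes M: "graph_module {p, q}" and "p < v" "v < q" "q < n"
  shows "E v p \<longleftrightarrow> \<not> E v q"
proof -
  have "v < n" "v \<notin> {p, q}" using assms by auto
  from M this show ?thesis
    using assms by (cases rule: graph_module_cases) (metis insertI1 insertI2 less_asym)+
qed

lemma small_hat_left:
  assumes M: "graph_module {h, q}" and "h < q"
  shows False
proof -
  have qn: "q < n" using M unfolding graph_module_def by auto
  have inner: "E x h \<longleftrightarrow> \<not> E x q" if "h < x" "x < q" for x
    using small_inner[OF M that qn] .
  \<comment> \<open>A neighbour of \<open>h\<close> or \<open>q\<close> outside the interval would
    be \<open>h\<close> itself by \<open>small_outer\<close>; a vertex strictly inside has its only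
    neighbour in \<open>{h, q}\<close>.\<close>
  have "nbr_closed {h..q}"
    unfolding nbr_closed_def
  proof (intro allI impI)
    fix x y assume x: "x \<in> {h..q}" and e: "E x y"
    show "y \<in> {h..q}"
    proof (cases "x = h \<or> x = q")
      case True
      then have "E y h \<or> E y q" using e E_sym by blast
      then show ?thesis using small_outer(1)[OF M assms(2), of y] assms(2) by force
    next
      case False
      then have "h < x" "x < q" using x by auto
      then have "y = h \<or> y = q" using inner E_unique[of x] e False by blast
      then show ?thesis using assms(2) by auto
    qed
  qed
  then have hq: "h = 0" "q = n - 1" using irred[OF assms(2) qn] by auto
  then have i: "E x 0 \<longleftrightarrow> \<not> E x q" if "x \<in> {1, 2, 3}" for x
  proof -
    have "0 < x \<and> x < 4" using that by auto
    then have "h < x" "x < q" using hq n_ge by linarith+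
    then show ?thesis using inner hq(1) by blast
  qed
  \<comment> \<open>With \<open>h = 0\<close>, vertex 1 must be the only neighbour of
    \<open>q\<close>. This leaves 2 and 3 adjacent to \<open>h\<close>, so \<open>a\<close> and
    \<open>b\<close> are consecutive.\<close>
  have "\<not> E 0 1" using short[of 0] hq by auto
  then have "E 1 q" using i[of 1] E_sym by auto
  then have "E q x \<Longrightarrow> x = 1" for x using E_unique[of q 1 x] E_sym assms(2) by auto
  then have "\<not> E 2 q" "\<not> E 3 q" using E_sym by force+
  then have "E 2 0" "E 3 0" using i[of 2] i[of 3] by simp_all
  then have "E 0 2" "E 0 3" using E_sym by blast+
  then have "2 = a \<or> 2 = b" "3 = a \<or> 3 = b" using E_hat[of 2] E_hat[of 3] hq(1) by simp_all
  then show False using not_adjacent by auto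
qed

lemma small_hat_right:
  assumes M: "graph_module {p, h}" and "p < h"
  shows False
proof -
  let ?r = "\<lambda>x. n - 1 - x"
  interpret R: good_quasi_pairing_graph n "\<lambda>x y. x < n \<and> y < n \<and> E (?r x) (?r y)" "?r h" "?r a" "?r b"
    by (rule reflect_good)
  have "R.graph_module {?r h, ?r p}" using reflect_module[OF M] by (simp add: insert_commute)
  moreover have "?r h < ?r p" using assms(2) hat_less by auto
  ultimately show False by (rule R.small_hat_left)
qed

text \<open>Every vertex strictly between \<open>p\<close> and \<open>q\<close> is the unique
  neighbour \<open>e\<close> of \<open>p\<close> or \<open>f\<close> of \<open>q\<close>, so
  \<open>q \<le> p + 3\<close> and few configurations remain.\<close>

lemma small_hat_notin:
  assumes M: "graph_module {p, q}" and pq: "p < q" and h: "h \<noteq> p" "h \<noteq> q"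
  shows False
proof -
  have qn: "q < n" using M unfolding graph_module_def by auto
  obtain e f where e: "E p e" and f: "E q f" using E_ex qn pq by (meson less_trans)
  have eu: "E p x \<longleftrightarrow> x = e" for x using E_unique[of p x e] h e by blast
  have fu: "E q x \<longleftrightarrow> x = f" for x using E_unique[of q x f] h f by blast
  have inner: "x = e \<longleftrightarrow> x \<noteq> f" if "p < x" "x < q" for x
    using small_inner[OF M that qn] eu fu E_sym by blast
  \<comment> \<open>Otherwise \<open>e = f = h\<close> lies outside the interval, so no vertex is
    left between \<open>p\<close> and \<open>q\<close>, which are \<open>a\<close> and
    \<open>b\<close> in some order.\<close>
  have ef: "p \<le> e \<and> e \<le> q \<and> p \<le> f \<and> f \<le> q"
  proof (rule ccontr)
    assume "\<not> ?thesis"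
    then obtain v where v: "v < p \<or> q < v" "E v p \<or> E v q" using e f E_sym not_le by blast
    have vh: "v = h" "{a, b} = {p, q}" by (rule small_outer[OF M pq v])+
    then have "E p h" "E q h" using E_hat E_sym by blast+
    then have "e = h" "f = h" using eu fu by auto
    then have "\<not> (p < p + 1 \<and> p + 1 < q)" using inner[of "p+1"] v vh by auto
    then have "q = p + 1" using pq by simp
    then show False using vh not_adjacent by (auto simp: doubleton_eq_iff)
  qed
  show False
  proof (cases "E p q")
    case True
    then have "e = q" using eu[of q] by simp
    moreover have "f = p" using E_sym[OF True] fu[of p] by simp
    ultimately have "\<not> (p < p + 1 \<and> p + 1 < q)" using inner[of "p+1"] by auto
    then have "q = p + 1" using pq by simp
    then show False using True short[of p] h by auto
  next
    case False
    have "e \<noteq> q" "f \<noteq> p" using False e f E_sym by auto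
    moreover have "e \<noteq> p" "f \<noteq> q" using e f E_neq by auto
    ultimately have i: "p < e" "e < q" "p < f" "f < q" using ef by auto
    then have "e \<noteq> f" using inner by blast
    have "p + 1 < q" using i by auto
    have in3: "x = e \<or> x = f" if "p < x" "x < q" for x using inner that by blast
    have "q \<le> p + 3"
    proof (rule ccontr)
      assume "\<not> q \<le> p + 3"
      then show False using in3[of "p+1"] in3[of "p+2"] in3[of "p+3"] by auto
    qed
    \<comment> \<open>Either two edges join consecutive vertices, and \<open>short\<close> gives two
      incompatible positions of \<open>h\<close>, or the edges cross and \<open>crossing\<close>
      puts \<open>h\<close> in \<open>{p, q}\<close>.\<close>
    then consider "q = p + 3" "e = p + 1" "f = p + 2" | "q = p + 3" "e = p + 2" "f = p + 1"
      using i \<open>e \<noteq> f\<close> by linarith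
    then show False
    proof cases
      case 1
      have "E p (p + 1)" "E (p + 2) (p + 2 + 1)" using 1 e f E_sym by (auto simp: numeral_3_eq_3)
      then show False using short[of p] short[of "p+2"] by auto
    next
      case 2
      then have "E p (p + 2)" "E (p + 1) (p + 3)" using e f E_sym by auto
      then show False using crossing[of p] h 2 by auto
    qed
  qed
qed

lemma modules_trivial:
  assumes "graph_module M"
  shows "M = {} \<or> M = {0..<n} \<or> is_singleton M"
proof -
  have fin: "finite M" using assms finite_subset unfolding graph_module_def by blast
  consider "card M = 0" | "card M = 1" | "card M = 2" | "3 \<le> card M" by linarith
  then show ?thesis
  proof cases
    case 1
    then show ?thesis using fin by simp
  next
    case 2
    then show ?thesis by (simp add: is_singleton_altdef)
  next
    case 3
    then obtain x y where "M = {x, y}" "x \<noteq> y" by (meson card_2_iff)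
    then obtain p q where "M = {p, q}" "p < q"
      by (metis insert_commute nat_neq_iff)
    then show ?thesis using assms small_hat_left small_hat_right small_hat_notin by metis
  next
    case 4
    then show ?thesis using large_module assms by blast
  qed
qed

end

section \<open>Necessity: a nontrivial module for each violated condition\<close>

context quasi_pairing_graph
begin

lemma nontrivial_moduleI:
  assumes triv: "\<forall>M. graph_module M \<longrightarrow> M = {} \<or> M = {0..<n} \<or> is_singleton M"
    and "graph_module M" "x \<in> M" "y \<in> M" "x \<noteq> y" "z < n" "z \<notin> M"
  shows False
proof -
  have "\<not> is_singleton M" using assms(3-5) by (auto simp: is_singleton_def)
  then show False using triv assms(2-7) by auto
qed

lemma good_if_modules_trivial:
  assumes triv: "\<forall>M. graph_module M \<longrightarrow> M = {} \<or> M = {0..<n} \<or> is_singleton M"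
  shows "good_quasi_pairing_graph n E h a b"
proof
  note bad = nontrivial_moduleI[OF triv]
  fix l u assume lu: "l < u" "u < n" "nbr_closed {l..u}"
  have "graph_module {l..u}"
    using lu by (intro nbr_closed_interval_module) (auto simp: order_interval_def)
  from bad[OF this, of l u] have "z \<in> {l..u}" if "z < n" for z using lu that by auto
  from this[of 0] this[of "n - 1"] have "0 \<in> {l..u}" "n - 1 \<in> {l..u}" using n_ge by auto
  then show "l = 0 \<and> u = n - 1" using lu by auto
next
  note bad = nontrivial_moduleI[OF triv]
  \<comment> \<open>Both \<open>p\<close> and \<open>p + 1\<close> have \<open>h\<close> as only
    neighbour and no vertex lies between them, so they form a module.\<close>
  have c: False if ab: "{a, b} = {p, p + 1}" for p
  proof -
    have p: "p \<in> {a, b}" "p + 1 \<in> {a, b}" using ab by auto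
    have "E v x \<longleftrightarrow> v = h" if "x \<in> {a, b}" for v x
    proof -
      have "E x h" "x \<noteq> h" using that E_hat E_sym hat_neq by auto
      then show ?thesis using E_unique[of x h v] E_sym by blast
    qed
    from this[OF p(1)] this[OF p(2)]
    have eh: "E v p \<longleftrightarrow> v = h" "E v (p + 1) \<longleftrightarrow> v = h" for v by blast+
    have pn: "p + 1 < n" using p hat_less by auto
    have "h \<notin> {p, p + 1}" unfolding ab[symmetric] using hat_neq by simp
    moreover have "graph_module {p, p + 1}"
      unfolding graph_module_pair eh using pn by presburger
    ultimately show False using bad[of "{p, p + 1}" p "p + 1" h] hat_less(1) by simp
  qed
  show "b \<noteq> a + 1" using c[of a] by auto
  show "a \<noteq> b + 1" using c[of b] by auto
next
  note bad = nontrivial_moduleI[OF triv]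
  fix v assume e: "E v (v + 2)" "E (v + 1) (v + 3)"
  show "h = v \<or> h = v + 3"
  proof (rule ccontr)
    assume h: "\<not> ?thesis"
    have vn: "v + 3 < n" using e E_less' by blast
    \<comment> \<open>The only vertices between \<open>v\<close> and \<open>v + 3\<close> are
      \<open>v + 1\<close> and \<open>v + 2\<close>, each adjacent to exactly one of the ends, on
      the side required.\<close>
    have eh: "E w v \<longleftrightarrow> w = v + 2" "E w (v + 3) \<longleftrightarrow> w = v + 1" for w
      using e h E_unique E_sym by metis+
    have "graph_module {v, v + 3}"
      unfolding graph_module_pair eh using vn by presburger
    then show False using bad[of "{v, v+3}" v "v+3" "v+1"] vn by auto
  qed
next
  note bad = nontrivial_moduleI[OF triv]
  fix v assume e: "E v (v + 1)"
  have vn: "v + 1 < n" using e E_less' by blast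
  have h: "h = v \<or> h = v + 1"
  proof (rule ccontr)
    assume h: "\<not> ?thesis"
    have eh: "E w v \<longleftrightarrow> w = v + 1" "E w (v + 1) \<longleftrightarrow> w = v" for w
      using e h E_unique E_sym by metis+
    have m: "graph_module {v, v + 1}"
      unfolding graph_module_pair eh using vn by presburger
    obtain z where "z < n" "z \<notin> {v, v + 1}"
      using n_ge vn by (cases "v = 0") (auto intro: that[of 0] that[of 2])
    then show False using bad[OF m, of v "v+1" z] by auto
  qed
  \<comment> \<open>The only neighbour of \<open>w\<close> is \<open>h\<close>, which here would be
    the only vertex on its side of \<open>w\<close>; the complement of \<open>{w}\<close> would then
    be a module.\<close>
  have not_end: "w \<noteq> 1 \<or> h \<noteq> 0" "w \<noteq> n - 2 \<or> h \<noteq> n - 1" if w: "E h w" for w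
  proof -
    have wn: "w < n" using w E_less' by blast
    have False if hw: "w = 1 \<and> h = 0 \<or> w = n - 2 \<and> h = n - 1"
    proof -
      have ew: "E w x \<longleftrightarrow> x = h" for x using w E_neq E_unique[of w h x] E_sym by metis
      let ?M = "{0..<n} - {w}"
      have "(\<forall>x\<in>?M. x < w \<longleftrightarrow> E w x) \<or> (\<forall>x\<in>?M. w < x \<longleftrightarrow> E w x)"
        using hw unfolding ew by (elim disjE; force)
      then have "graph_module ?M" unfolding graph_module_def by simp
      moreover have "h \<in> ?M" "2 \<in> ?M" "h \<noteq> 2" using hw n_ge by auto
      ultimately show False using bad[of ?M h 2 w] wn by simp
    qed
    then show "w \<noteq> 1 \<or> h \<noteq> 0" "w \<noteq> n - 2 \<or> h \<noteq> n - 1" by blast+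
  qed
  show "(h = v \<or> h = v + 1) \<and> h \<noteq> 0 \<and> h \<noteq> n - 1"
    using h
  proof
    assume "h = v"
    then show ?thesis using not_end[of "v+1"] e vn by auto
  next
    assume hv: "h = v + 1"
    then have "E h v" using e E_sym by blast
    then show ?thesis using not_end[of v] hv by auto
  qed
qed

end

section \<open>Translation between tournaments with quasi-pairings and graphs\<close>

lemma quasi_pairing_graph_of_quasi_pairing:
  assumes "5 \<le> n" and qp: "quasi_pairing {0..<n} Q"
  shows "quasi_pairing_graph n (\<lambda>x y. {x, y} \<in> Q) (v_hat Q) (v_minus Q) (v_plus Q)"
proof
  let ?h = "v_hat Q" and ?a = "v_minus Q" and ?b = "v_plus Q"
  have Q: "\<Union>Q = {0..<n}" "\<And>e. e \<in> Q \<Longrightarrow> card e = 2"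
    using qp by (auto simp: quasi_pairing_def nsets_def)
  note mp = v_minus_plus_quasi_pairing[OF qp]
  show "5 \<le> n" by fact
  fix x y z
  show "{x, y} \<in> Q \<Longrightarrow> {y, x} \<in> Q" by (simp add: insert_commute)
  show "{x, y} \<in> Q \<Longrightarrow> x < n" using Q(1) by auto
  show "{x, y} \<in> Q \<Longrightarrow> x \<noteq> y" using Q(2)[of "{x, y}"] by auto
  show "\<exists>y. {x, y} \<in> Q" if "x < n"
  proof -
    have "x \<in> \<Union>Q" using Q(1) that by simp
    then obtain e where e: "e \<in> Q" "x \<in> e" by blast
    obtain u v where "e = {u, v}" using Q(2)[OF e(1)] by (meson card_2_iff)
    then show ?thesis using e by (auto simp: insert_commute)
  qed
  show "y = z" if "x \<noteq> ?h" "{x, y} \<in> Q" "{x, z} \<in> Q"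
  proof -
    have "x \<in> {0..<n}" using Q(1) that by blast
    then have "card {e \<in> Q. x \<in> e} = 1" using v_hat_quasi_pairing(3)[OF qp] that by blast
    then obtain f where f: "{e \<in> Q. x \<in> e} = {f}" by (rule card_1_singletonE)
    have "{x, y} \<in> {e \<in> Q. x \<in> e}" "{x, z} \<in> {e \<in> Q. x \<in> e}" using that(2,3) by simp_all
    then have "{x, y} = {x, z}" unfolding f by simp
    then show ?thesis by (auto simp: doubleton_eq_iff)
  qed
  show "{?h, y} \<in> Q \<longleftrightarrow> y = ?a \<or> y = ?b"
  proof -
    have "{?h, y} \<in> Q \<longleftrightarrow> {?h, y} \<in> {e \<in> Q. ?h \<in> e}" by blast
    also have "\<dots> \<longleftrightarrow> y = ?a \<or> y = ?b" unfolding mp(4) using mp(2,3) by (auto simp: doubleton_eq_iff)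
    finally show ?thesis .
  qed
  show "?a \<noteq> ?b" using mp(1) by simp
qed

lemma order_interval_atLeastAtMost:
  fixes I :: "nat set"
  assumes "order_interval {0..<n} I" "I \<noteq> {}"
  shows "I = {Min I..Max I}"
proof -
  have I: "I \<subseteq> {0..<n}" using assms(1) by (simp add: order_interval_def)
  then have fin: "finite I" using finite_subset by blast
  have mm: "Min I \<in> I" "Max I \<in> I" using fin assms(2) by auto
  have "x \<in> I" if "x \<in> {Min I..Max I}" for x
  proof (rule ccontr)
    assume x: "x \<notin> I"
    have "x < n" using that mm I by (metis atLeastAtMost_iff atLeastLessThan_iff le_less_trans subsetD)
    then have "(\<forall>y\<in>I. y < x) \<or> (\<forall>y\<in>I. x < y)" using x assms(1) unfolding order_interval_def by auto
    then show False using mm that by force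
  qed
  moreover have "x \<in> {Min I..Max I}" if "x \<in> I" for x using fin that by simp
  ultimately show ?thesis by (intro equalityI subsetI)
qed

text \<open>Every edge lies in a block, and every block is connected: it is an edge or the path from
  \<open>v_minus Q\<close> through \<open>v_hat Q\<close> to \<open>v_plus Q\<close>.\<close>

lemma union_of_blocks_iff_nbr_closed:
  assumes "5 \<le> n" and qp: "quasi_pairing {0..<n} Q" and I: "I \<subseteq> {0..<n}"
  shows "(\<exists>S\<subseteq>Q_part Q. I = \<Union>S) \<longleftrightarrow> quasi_pairing_graph.nbr_closed (\<lambda>x y. {x, y} \<in> Q) I"
proof -
  let ?h = "v_hat Q" and ?a = "v_minus Q" and ?b = "v_plus Q"
  interpret quasi_pairing_graph n "\<lambda>x y. {x, y} \<in> Q" ?h ?a ?b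
    using assms(1,2) by (rule quasi_pairing_graph_of_quasi_pairing)
  have part: "partition_on {0..<n} (Q_part Q)" using qp by (rule partition_on_Q_part)
  have block: "\<exists>B\<in>Q_part Q. {x, y} \<subseteq> B" if "{x, y} \<in> Q" for x y
  proof (cases "{x, y} \<in> Q_part Q")
    case False
    then have "{x, y} = {?h, ?a} \<or> {x, y} = {?h, ?b}" using that by (simp add: Q_part_def)
    then have "{x, y} \<subseteq> {?h, ?a, ?b}" by auto
    then show ?thesis by (simp add: Q_part_def B_block_def)
  qed blast
  have two: "\<exists>x y. B = {x, y}" if "B \<in> Q" for B
  proof -
    have "card B = 2" using that qp by (auto simp: quasi_pairing_def nsets_def)
    then show ?thesis by (meson card_2_iff)
  qed
  show ?thesis
  proof
    assume "\<exists>S\<subseteq>Q_part Q. I = \<Union>S"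
    then obtain S where S: "S \<subseteq> Q_part Q" "I = \<Union>S" by blast
    show "nbr_closed I"
      unfolding nbr_closed_def
    proof (intro allI impI)
      fix x y assume x: "x \<in> I" "{x, y} \<in> Q"
      obtain B where B: "B \<in> Q_part Q" "{x, y} \<subseteq> B" using block x by blast
      obtain C where C: "C \<in> S" "x \<in> C" using x S by blast
      have "B \<inter> C \<noteq> {}" "C \<in> Q_part Q" using B(2) C S(1) by blast+
      then have "B = C" using disjointD[OF partition_onD2[OF part] B(1)] by blast
      then show "y \<in> I" using B C S by blast
    qed
  next
    assume cl: "nbr_closed I"
    have sub: "B \<subseteq> I" if B: "B \<in> Q_part Q" "x \<in> B" "x \<in> I" for B x
    proof (cases "B \<in> Q")
      case True
      then obtain u v where uv: "B = {u, v}" using two by blast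
      then have "{u, v} \<in> Q" "{v, u} \<in> Q" using True by (auto simp: insert_commute)
      then show ?thesis using cl B uv unfolding nbr_closed_def by blast
    next
      case False
      then have BB: "B = {?h, ?a, ?b}" using B(1) by (auto simp: Q_part_def B_block_def)
      \<comment> \<open>Every element of the three-element block is \<open>?h\<close> or adjacent to
        it, so closure reaches \<open>?h\<close> first and then the whole block.\<close>
      have "?h \<in> I" 
        using B BB cl E_hat E_sym unfolding nbr_closed_def by (metis empty_iff insertE)
      then show ?thesis using BB cl E_hat unfolding nbr_closed_def by blast
    qed
    have "I = \<Union>{B \<in> Q_part Q. B \<subseteq> I}"
    proof (intro equalityI subsetI)
      fix x assume x: "x \<in> I"
      then obtain B where "B \<in> Q_part Q" "x \<in> B" using partition_onD1[OF part] I by blast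
      then show "x \<in> \<Union>{B \<in> Q_part Q. B \<subseteq> I}" using sub[of B x] x by blast
    next
      fix x assume "x \<in> \<Union>{B \<in> Q_part Q. B \<subseteq> I}"
      then show "x \<in> I" by auto
    qed
    moreover have "{B \<in> Q_part Q. B \<subseteq> I} \<subseteq> Q_part Q" by simp
    ultimately show "\<exists>S\<subseteq>Q_part Q. I = \<Union>S" by (intro exI conjI)
  qed
qed

text \<open>Nontrivial intervals are the sets \<open>{l..u}\<close> with \<open>l < u < n\<close>
  other than \<open>{0..<n}\<close>, and for them being a union of blocks means being closed under
  neighbours.\<close>

lemma irreducible_quasi_pairing_iff:
  assumes "5 \<le> n" and qp: "quasi_pairing {0..<n} Q"
  shows "irreducible_quasi_pairing {0..<n} Q \<longleftrightarrow>
    (\<forall>l u. l < u \<longrightarrow> u < n \<longrightarrow> quasi_pairing_graph.nbr_closed (\<lambda>x y. {x, y} \<in> Q) {l..u} \<longrightarrow> l = 0 \<and> u = n - 1)"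
    (is "_ \<longleftrightarrow> ?R")
proof -
  interpret quasi_pairing_graph n "\<lambda>x y. {x, y} \<in> Q" "v_hat Q" "v_minus Q" "v_plus Q"
    using assms by (rule quasi_pairing_graph_of_quasi_pairing)
  have "irreducible_quasi_pairing {0..<n} Q \<longleftrightarrow> (\<forall>I. nontrivial_interval {0..<n} I \<longrightarrow> \<not> nbr_closed I)"
  proof -
    have "(\<exists>S\<subseteq>Q_part Q. I = \<Union>S) \<longleftrightarrow> nbr_closed I" if "nontrivial_interval {0..<n} I" for I
      using that unfolding nontrivial_interval_def order_interval_def
      by (intro union_of_blocks_iff_nbr_closed[OF assms]) simp
    then show ?thesis
      using qp partition_on_Q_part[OF qp]
      unfolding irreducible_quasi_pairing_def irreducible_partition_def by (metis (no_types, lifting))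
  qed
  also have "\<dots> \<longleftrightarrow> ?R"
  proof
    assume L: "\<forall>I. nontrivial_interval {0..<n} I \<longrightarrow> \<not> nbr_closed I"
    show ?R
    proof (intro allI impI)
      fix l u assume lu: "l < u" "u < n" "nbr_closed {l..u}"
      have "order_interval {0..<n} {l..u}" using lu by (auto simp: order_interval_def)
      moreover have "\<not> is_singleton {l..u}" using lu by (auto simp: is_singleton_altdef)
      ultimately have "{l..u} = {0..<n}" using L lu unfolding nontrivial_interval_def by auto
      then have "0 \<in> {l..u}" "n - 1 \<in> {l..u}" using n_ge by auto
      then show "l = 0 \<and> u = n - 1" using lu by auto
    qed
  next
    assume R: ?R
    show "\<forall>I. nontrivial_interval {0..<n} I \<longrightarrow> \<not> nbr_closed I"
    proof (intro allI impI notI)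
      fix I assume I: "nontrivial_interval {0..<n} I" and cl: "nbr_closed I"
      have oi: "order_interval {0..<n} I" "I \<noteq> {}" "\<not> is_singleton I" "I \<noteq> {0..<n}"
        using I by (auto simp: nontrivial_interval_def)
      define l u where "l = Min I" and "u = Max I"
      have eq: "I = {l..u}" using order_interval_atLeastAtMost[OF oi(1,2)] unfolding l_def u_def .
      have "l < u" using eq oi(2,3) by (cases l u rule: linorder_cases) auto
      moreover have "u \<in> I" using eq calculation by simp
      then have "u < n" using oi(1) unfolding order_interval_def by auto
      ultimately have "l = 0 \<and> u = n - 1" using R cl eq by blast
      then have "I = {0..<n}" using eq n_ge by auto
      then show False using oi by blast
    qed
  qed
  finally show ?thesis .
qed

text \<open>An arc points downwards exactly when its pair is in \<open>Q\<close>; read for the arcs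
  between \<open>v\<close> and \<open>M\<close>, this turns domination into the adjacency
  alternatives.\<close>

lemma tmodule_iff_graph_module:
  assumes "5 \<le> n" and "quasi_pairing {0..<n} Q"
  shows "tmodule (Inv (transitive_tournament {0..<n}) Q) M \<longleftrightarrow>
    quasi_pairing_graph.graph_module n (\<lambda>x y. {x, y} \<in> Q) M"
proof -
  interpret quasi_pairing_graph n "\<lambda>x y. {x, y} \<in> Q" "v_hat Q" "v_minus Q" "v_plus Q"
    using assms by (rule quasi_pairing_graph_of_quasi_pairing)
  let ?T = "Inv (transitive_tournament {0..<n}) Q"
  have arc: "(x, y) \<in> parcs ?T \<longleftrightarrow> (x < y \<longleftrightarrow> {x, y} \<notin> Q)" if "x < n" "y < n" "x \<noteq> y" for x y
    using that by (auto simp: Inv_def transitive_tournament_def insert_commute)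
  have V: "pverts ?T = {0..<n}" by (simp add: Inv_def transitive_tournament_def)
  show ?thesis
  proof (cases "M \<subseteq> {0..<n}")
    case True
    have "{v} \<times> M \<subseteq> parcs ?T \<longleftrightarrow> (\<forall>x\<in>M. x < v \<longleftrightarrow> {v, x} \<in> Q)"
         "M \<times> {v} \<subseteq> parcs ?T \<longleftrightarrow> (\<forall>x\<in>M. v < x \<longleftrightarrow> {v, x} \<in> Q)" if v: "v < n" "v \<notin> M" for v
    proof -
      have "(v, x) \<in> parcs ?T \<longleftrightarrow> (x < v \<longleftrightarrow> {v, x} \<in> Q)"
        "(x, v) \<in> parcs ?T \<longleftrightarrow> (v < x \<longleftrightarrow> {v, x} \<in> Q)" if "x \<in> M" for x
      proof -
        have "x < n" "x \<noteq> v" using that v True by auto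
        then show "(v, x) \<in> parcs ?T \<longleftrightarrow> (x < v \<longleftrightarrow> {v, x} \<in> Q)"
          "(x, v) \<in> parcs ?T \<longleftrightarrow> (v < x \<longleftrightarrow> {v, x} \<in> Q)"
          using arc[of v x] arc[of x v] v(1) by (auto simp: insert_commute)
      qed
      then show "{v} \<times> M \<subseteq> parcs ?T \<longleftrightarrow> (\<forall>x\<in>M. x < v \<longleftrightarrow> {v, x} \<in> Q)"
         "M \<times> {v} \<subseteq> parcs ?T \<longleftrightarrow> (\<forall>x\<in>M. v < x \<longleftrightarrow> {v, x} \<in> Q)" by blast+
    qed
    then show ?thesis using True unfolding tmodule_def graph_module_def V by auto
  next
    case False
    then show ?thesis unfolding tmodule_def graph_module_def V by blast
  qed
qed

theorem corollary3p3:
  fixes n :: nat and Q :: "nat set set"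
  assumes "odd n" and "n \<ge> 5"
    and "quasi_pairing {0..<n} Q"
  shows "indecomposable (Inv (transitive_tournament {0..<n}) Q) \<longleftrightarrow>
           irreducible_quasi_pairing {0..<n} Q
         \<and> v_plus Q \<ge> v_minus Q + 2
         \<and> (\<forall>v \<in> {0..<n}. {{v, v + 2}, {v + 1, v + 3}} \<subseteq> Q \<longrightarrow> v_hat Q \<in> {v, v + 3})
         \<and> (\<forall>v \<in> {0..<n}. {v, v + 1} \<in> Q \<longrightarrow> v_hat Q \<in> {v, v + 1} - {0, n - 1})"
    (is "?L \<longleftrightarrow> ?R")
proof -
  let ?E = "\<lambda>x y. {x, y} \<in> Q"
  interpret G: quasi_pairing_graph n ?E "v_hat Q" "v_minus Q" "v_plus Q"
    using assms(2,3) by (rule quasi_pairing_graph_of_quasi_pairing)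
  have lt: "v_minus Q < v_plus Q" using v_minus_plus_quasi_pairing(1)[OF assms(3)] .
  have "pverts (Inv (transitive_tournament {0..<n}) Q) = {0..<n}"
    by (simp add: Inv_def transitive_tournament_def)
  then have "?L \<longleftrightarrow> (\<forall>M. G.graph_module M \<longrightarrow> M = {} \<or> M = {0..<n} \<or> is_singleton M)"
    unfolding indecomposable_def by (simp add: tmodule_iff_graph_module[OF assms(2,3)])
  also have "\<dots> \<longleftrightarrow> good_quasi_pairing_graph n ?E (v_hat Q) (v_minus Q) (v_plus Q)"
    using G.good_if_modules_trivial good_quasi_pairing_graph.modules_trivial by blast
  also have "\<dots> \<longleftrightarrow> ?R"
  proof
    assume "good_quasi_pairing_graph n ?E (v_hat Q) (v_minus Q) (v_plus Q)"
    then interpret good_quasi_pairing_graph n ?E "v_hat Q" "v_minus Q" "v_plus Q" .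
    have "irreducible_quasi_pairing {0..<n} Q"
      using irreducible_quasi_pairing_iff[OF assms(2,3)] irred by blast
    then show ?R using lt not_adjacent crossing short by auto
  next
    assume R: ?R
    show "good_quasi_pairing_graph n ?E (v_hat Q) (v_minus Q) (v_plus Q)"
    proof
      show "l = 0 \<and> u = n - 1" if "l < u" "u < n" "G.nbr_closed {l..u}" for l u
        using R irreducible_quasi_pairing_iff[OF assms(2,3)] that by blast
      show "v_plus Q \<noteq> v_minus Q + 1" "v_minus Q \<noteq> v_plus Q + 1" using R lt by auto
      show "v_hat Q = v \<or> v_hat Q = v + 3" if "{v, v + 2} \<in> Q" "{v + 1, v + 3} \<in> Q" for v
      proof -
        have "v < n" using that(1) by (rule G.E_less)
        then show ?thesis using R that by auto
      qed
      show "(v_hat Q = v \<or> v_hat Q = v + 1) \<and> v_hat Q \<noteq> 0 \<and> v_hat Q \<noteq> n - 1" if "{v, v + 1} \<in> Q" for v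
      proof -
        have "v < n" using that by (rule G.E_less)
        then show ?thesis using R that by auto
      qed
    qed
  qed
  finally show ?thesis .
qed

end
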